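(* Let $S$ and $T$ be quandles and $h:S\to T$ a quandle homomorphism. If $a$ and $b$ are in the same component of $S$, then $h(a)$ and $h(b)$ are in the same component of $T$.
   Context: A quandle is a set $Q$ with a binary operation $\triangleright$ such that $x\triangleright x=x$; for all $y,z$ there is a unique $x$ with $y\triangleright x=z$; and $x\triangleright(y\triangleright z)=(x\triangleright y)\triangleright(x\triangleright z)$. The components of $Q$ are the orbits of the action on $Q$ of the group $\mathrm{Inn}(Q)$ generated by the bijections $L_a:x\mapsto a\triangleright x$, $a\in Q$. *)

theory Defs
  imports "HOL-Algebra.Algebra"
begin

locale quandle =
  fixes Q :: "'a set" and op :: "'a \<Rightarrow> 'a \<Rightarrow> 'a" (infixl "\<triangleright>" 70)
  assumes closed: "\<lbrakk>x \<in> Q; y \<in> Q\<rbrakk> \<Longrightarrow> x \<triangleright> y \<in> Q"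
    and idem: "x \<in> Q \<Longrightarrow> x \<triangleright> x = x"
    and left_div: "\<lbrakk>y \<in> Q; z \<in> Q\<rbrakk> \<Longrightarrow> \<exists>!x. x \<in> Q \<and> y \<triangleright> x = z"
    and left_distrib: "\<lbrakk>x \<in> Q; y \<in> Q; z \<in> Q\<rbrakk> \<Longrightarrow> x \<triangleright> (y \<triangleright> z) = (x \<triangleright> y) \<triangleright> (x \<triangleright> z)"

definition quandle_hom ::
  "'a set \<Rightarrow> ('a \<Rightarrow> 'a \<Rightarrow> 'a) \<Rightarrow> 'b set \<Rightarrow> ('b \<Rightarrow> 'b \<Rightarrow> 'b) \<Rightarrow> ('a \<Rightarrow> 'b) set"
  where "quandle_hom S opS T opT =
    {h \<in> S \<rightarrow> T. \<forall>x\<in>S. \<forall>y\<in>S. h (opS x y) = opT (h x) (h y)}"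

text \<open>The left translation \<open>L\<^sub>a\<close>, restricted to \<open>Q\<close> because elements of
  \<^term>\<open>BijGroup Q\<close> are extensional functions.\<close>

definition left_trans :: "'a set \<Rightarrow> ('a \<Rightarrow> 'a \<Rightarrow> 'a) \<Rightarrow> 'a \<Rightarrow> 'a \<Rightarrow> 'a"
  where "left_trans Q op a = (\<lambda>x\<in>Q. op a x)"

definition Inn :: "'a set \<Rightarrow> ('a \<Rightarrow> 'a \<Rightarrow> 'a) \<Rightarrow> ('a \<Rightarrow> 'a) monoid"
  where "Inn Q op =
    (BijGroup Q)\<lparr>carrier := generate (BijGroup Q) (left_trans Q op ` Q)\<rparr>"

definition components :: "'a set \<Rightarrow> ('a \<Rightarrow> 'a \<Rightarrow> 'a) \<Rightarrow> 'a set set"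
  where "components Q op = orbits (Inn Q op) Q (\<lambda>g. g)"

definition same_component :: "'a set \<Rightarrow> ('a \<Rightarrow> 'a \<Rightarrow> 'a) \<Rightarrow> 'a \<Rightarrow> 'a \<Rightarrow> bool"
  where "same_component Q op a b \<longleftrightarrow> (\<exists>C\<in>components Q op. a \<in> C \<and> b \<in> C)"

end

theory Submission
  imports Defs
begin

text \<open>Although \<open>h\<close> need not induce a homomorphism of inner automorphism groups, every inner
  automorphism \<open>g\<close> of \<open>S\<close> has a companion \<open>k\<close> in \<open>Inn T\<close> with \<open>h \<circ> g = k \<circ> h\<close>: replace each
  letter \<open>L\<^sub>a\<close> in a word for \<open>g\<close> by \<open>L\<^bsub>h a\<^esub>\<close>. So \<open>h\<close> maps orbits into orbits.\<close>

context quandle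
begin

text \<open>Uniqueness in left division gives injectivity, existence gives surjectivity.\<close>

lemma left_trans_Bij:
  assumes "a \<in> Q"
  shows "left_trans Q (\<triangleright>) a \<in> Bij Q"
proof -
  have "inj_on (\<lambda>x. a \<triangleright> x) Q"
    using left_div[OF assms] closed[OF assms] by (intro inj_onI) metis
  moreover have "(\<lambda>x. a \<triangleright> x) ` Q = Q"
  proof
    show "(\<lambda>x. a \<triangleright> x) ` Q \<subseteq> Q"
      using closed[OF assms] by blast
    show "Q \<subseteq> (\<lambda>x. a \<triangleright> x) ` Q"
      using left_div[OF assms] by blast
  qed
  ultimately have "bij_betw (\<lambda>x. a \<triangleright> x) Q Q"
    by (simp add: bij_betw_def)
  then show ?thesis
    by (simp add: left_trans_def Bij_def)
qed

text \<open>Multiplication in \<open>BijGroup\<close> is an abstraction restricted to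
  \<open>Bij\<close>, so a product can be evaluated as a composition only once both factors are
  known to be bijections.\<close>

lemma generate_left_trans_Bij:
  assumes "g \<in> generate (BijGroup Q) (left_trans Q (\<triangleright>) ` Q)"
  shows "g \<in> Bij Q"
proof -
  have "left_trans Q (\<triangleright>) ` Q \<subseteq> carrier (BijGroup Q)"
    using left_trans_Bij by (auto simp: BijGroup_def)
  then show ?thesis
    using group.generate_in_carrier[OF group_BijGroup _ assms] by (simp add: BijGroup_def)
qed

text \<open>A component is presented as the orbit of some base point \<open>x\<close>; keeping
  \<open>x\<close> explicit lets \<open>h x\<close> be the base point of the component in the
  target.\<close>

lemma same_component_iff:
  "same_component Q (\<triangleright>) a b \<longleftrightarrow>
    (\<exists>x\<in>Q. \<exists>g\<in>carrier (Inn Q (\<triangleright>)). \<exists>g'\<in>carrier (Inn Q (\<triangleright>)). a = g x \<and> b = g' x)"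
  by (auto simp: same_component_def components_def orbits_def orbit_def)

end

lemma inv_BijGroup_apply:
  assumes "f \<in> Bij Q" "x \<in> Q"
  shows "(inv\<^bsub>BijGroup Q\<^esub> f) x \<in> Q" "f ((inv\<^bsub>BijGroup Q\<^esub> f) x) = x"
  using assms by (auto simp: inv_BijGroup Bij_def bij_betw_def inv_into_into f_inv_into_f)

text \<open>By injectivity of \<open>f\<close>, any preimage of \<open>x\<close> found in
  \<open>Q\<close> is the value of the inverse at \<open>x\<close>.\<close>

lemma inv_BijGroup_eqI:
  assumes "f \<in> Bij Q" "y \<in> Q" "f y = x"
  shows "(inv\<^bsub>BijGroup Q\<^esub> f) x = y"
  using assms by (auto simp: inv_BijGroup Bij_def bij_betw_def)

lemma quandle_hom_intertwines_Inn:
  assumes S: "quandle S opS" and T: "quandle T opT"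
    and h: "h \<in> quandle_hom S opS T opT"
    and g: "g \<in> carrier (Inn S opS)"
  shows "\<exists>k\<in>carrier (Inn T opT). \<forall>x\<in>S. h (g x) = k (h x)"
proof -
  interpret S: quandle S opS by (rule S)
  interpret T: quandle T opT by (rule T)
  let ?A = "left_trans S opS ` S" and ?B = "left_trans T opT ` T"
  have hT: "h x \<in> T" if "x \<in> S" for x
    using h that by (auto simp: quandle_hom_def)
  have comm: "h (left_trans S opS a x) = left_trans T opT (h a) (h x)"
    if "a \<in> S" "x \<in> S" for a x
    using h that hT by (simp add: quandle_hom_def left_trans_def)
  have "g \<in> generate (BijGroup S) ?A"
    using g by (simp add: Inn_def)
  then have "\<exists>k\<in>generate (BijGroup T) ?B. \<forall>x\<in>S. h (g x) = k (h x)"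
  proof induction
    case one
    show ?case
      by (rule bexI[OF _ generate.one]) (simp add: BijGroup_def hT)
  next
    case (incl f)
    then obtain a where a: "a \<in> S" "f = left_trans S opS a" by blast
    show ?case
      by (rule bexI[OF _ generate.incl[of "left_trans T opT (h a)"]]) (use a hT comm in auto)
  next
    case (inv f)
    then obtain a where a: "a \<in> S" "f = left_trans S opS a" by blast
    have f: "f \<in> Bij S"
      using a S.left_trans_Bij by simp
    have "h ((inv\<^bsub>BijGroup S\<^esub> f) x) = (inv\<^bsub>BijGroup T\<^esub> (left_trans T opT (h a))) (h x)"
      if "x \<in> S" for x
    proof (rule inv_BijGroup_eqI[symmetric])
      show "left_trans T opT (h a) \<in> Bij T"
        using a hT T.left_trans_Bij by simp
      show "h ((inv\<^bsub>BijGroup S\<^esub> f) x) \<in> T"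
        using inv_BijGroup_apply(1)[OF f that] hT by simp
      \<comment> \<open>With \<open>y\<close> the preimage of \<open>x\<close> under
        \<open>f\<close>, \<open>comm\<close> at \<open>y\<close> turns the left side into
        \<open>h (f y)\<close>, which is \<open>h x\<close>.\<close>
      show "left_trans T opT (h a) (h ((inv\<^bsub>BijGroup S\<^esub> f) x)) = h x"
        using inv_BijGroup_apply[OF f that] comm[OF a(1)] a(2) by metis
    qed
    then show ?case
      by (intro bexI[OF _ generate.inv[of "left_trans T opT (h a)"]]) (use a hT in auto)
  next
    case (eng f f')
    then obtain k k' where k: "k \<in> generate (BijGroup T) ?B" "\<forall>x\<in>S. h (f x) = k (h x)"
      and k': "k' \<in> generate (BijGroup T) ?B" "\<forall>x\<in>S. h (f' x) = k' (h x)" by blast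
    note Bij = eng.hyps[THEN S.generate_left_trans_Bij]
      k(1)[THEN T.generate_left_trans_Bij] k'(1)[THEN T.generate_left_trans_Bij]
    \<comment> \<open>This allows the hypothesis on \<open>f\<close> to be used at
      \<open>f' x\<close>: \<open>h (f (f' x)) = k (h (f' x)) = k (k' (h x))\<close>.\<close>
    have "f' x \<in> S" if "x \<in> S" for x
      using Bij(2) that by (auto simp: Bij_def bij_betw_def)
    then show ?case
      by (intro bexI[OF _ generate.eng[OF k(1) k'(1)]])
        (use Bij k(2) k'(2) hT in \<open>auto simp: BijGroup_def compose_def\<close>)
  qed
  then show ?thesis
    by (simp add: Inn_def)
qed

theorem lemma3p1:
  fixes S :: "'a set" and opS :: "'a \<Rightarrow> 'a \<Rightarrow> 'a"
    and T :: "'b set" and opT :: "'b \<Rightarrow> 'b \<Rightarrow> 'b"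
    and h :: "'a \<Rightarrow> 'b" and a b :: 'a
  assumes "quandle S opS"
    and "quandle T opT"
    and "h \<in> quandle_hom S opS T opT"
    and "same_component S opS a b"
  shows "same_component T opT (h a) (h b)"
proof -
  obtain x g g' where x: "x \<in> S" and g: "g \<in> carrier (Inn S opS)" "g' \<in> carrier (Inn S opS)"
    and ab: "a = g x" "b = g' x"
    using assms(4) quandle.same_component_iff[OF assms(1)] by metis
  \<comment> \<open>The companions of \<open>g\<close> and \<open>g'\<close> send the common point
    \<open>h x\<close> to \<open>h a\<close> and \<open>h b\<close>.\<close>
  obtain k k' where "k \<in> carrier (Inn T opT)" "k' \<in> carrier (Inn T opT)"
    "h a = k (h x)" "h b = k' (h x)"
    using quandle_hom_intertwines_Inn[OF assms(1-3)] g x ab by metis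
  moreover have "h x \<in> T"
    using assms(3) x by (auto simp: quandle_hom_def)
  ultimately show ?thesis
    using quandle.same_component_iff[OF assms(2)] by metis
qed

end
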